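(* Let $u_h^0\in V_h^d$ and suppose that $u_h^n\in V_h^d$, $n=1,\dots,N$, solves the fully discrete scheme $$\Big(\sum_{k=1}^{n}\bar c_{n,k}(u_h^k-u_h^{k-1}),v_h\Big)+\kappa_s\mathcal A_h(u_h^n,v_h)=(f^n,v_h)\qquad\forall v_h\in V_h^d,\quad n=1,\dots,N,$$ where $f^n=f(\cdot,t_n)\in L^2(\Omega)$. Define $\theta_{n,n}=1$ and $$\theta_{n,j}=\Gamma(2-\alpha)\sum_{k=j}^{n-1}\Delta t_k^\alpha\,\theta_{k,j}\,(\bar c_{n,k+1}-\bar c_{n,k}),\qquad j=1,2,\dots,n-1.$$ Then $$\|u_h^n\|\le\|u_h^0\|+\frac1{\bar c_{n,n}}\sum_{j=1}^n\theta_{n,j}\|f^j\|,\qquad n=1,2,\dots,N,$$ where $1/\bar c_{n,n}=\tau_n$.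
   Context: Setting. $0<\alpha<1$, $0<s<1$, $\gamma\ge0$, $\kappa_s>0$, $T>0$, $\Omega=\prod_{k=1}^d(a_k,b_k)\subset\mathbb R^d$, $d\in\{1,2,3\}$; $(\cdot,\cdot)$ and $\|\cdot\|$ are the $L^2(\Omega)$ inner product and norm. Space discretization. $V_h^d\subset H_0^1(\Omega)$ is the tensor-product finite element space on a uniform Cartesian mesh of $\Omega$ (continuous, vanishing on $\partial\Omega$; piecewise (multi)linear, or more generally of degree $r\ge1$). $M$ and $S$ are its mass and stiffness matrices, $\pi_h$ is the linear bijection sending a function of $V_h^d$ to its coefficient vector, and $(-\Delta_h+\gamma\mathbb I)^s:=\pi_h^{-1}(M^{-1}S+\gamma I)^s\pi_h$ on $V_h^d$ (the fractional power of the positive, $L^2$-self-adjoint discrete operator, defined spectrally). Put $\mathcal A_h(u_h,v_h)=((-\Delta_h+\gamma\mathbb I)^su_h,v_h)$ for $u_h,v_h\in V_h^d$. Time discretization. Graded mesh $t_n=T(n/N)^\omega$, $\omega\ge1$, $n=0,\dots,N$; $\Delta t_n=t_n-t_{n-1}$; $\tau_n=\Delta t_n^\alpha\,\Gamma(2-\alpha)$. Let $Q>1$ be an integer, $w_j=-\frac{\sin(\alpha\pi)}{\pi}\Delta y\,e^{(1+\alpha)y_j}<0$, $\xi_j=-e^{y_j}<0$, $y_j=y_{\min}+(j-1)\Delta y$, $\Delta y=(y_{\max}-y_{\min})/(Q-1)$, $j=1,\dots,Q$, so that $\sum_{j=1}^Q w_je^{\xi_jt}$ approximates $t^{-1-\alpha}/\Gamma(-\alpha)$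 on $[t_1,T]$ up to an error $O(\epsilon t^{-1-\alpha})$ with a given small precision $\epsilon>0$. For a sequence $\{\rho(t_k)\}$ define $Y_j(t_0)=0$ and $Y_j(t_i)=e^{z}Y_j(t_{i-1})+\frac1{\xi_j}\big(e^z-1-\frac{e^z-z-1}{z}\big)\rho(t_{i-1})+\frac1{\xi_j}\frac{e^z-z-1}{z}\rho(t_i)$ with $z=\xi_j\Delta t_i$. Define the coefficients $b_k^n$ by $$\sum_{k=0}^nb_k^n\rho(t_k)=\frac{\rho(t_n)-\alpha\rho(t_{n-1})-(1-\alpha)(\Delta t_n/t_n)^\alpha\rho(t_0)}{\tau_n}+\sum_{j=1}^Qw_je^{\xi_j\Delta t_n}Y_j(t_{n-1}),$$ (the last sum is zero for $n=1$), and set $\bar c_{n,1}=-b_0^n$, $\bar c_{n,k}=\bar c_{n,k-1}-b_{k-1}^n$ for $2\le k\le n-1$, and $\bar c_{n,n}=b_n^n=1/\tau_n$. Standing property of these coefficients (taken as given): $\bar c_{n,n}\ge\bar c_{n,n-1}\ge\cdots\ge\bar c_{n,1}\ge\frac{t_n^{-\alpha}}{\Gamma(1-\alpha)}>0$ for all $n$. *)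

theory Defs
  imports "HOL-Analysis.Analysis" "Jordan_Normal_Form.Gauss_Jordan_Elimination"
begin

section \<open>The space \<open>L\<^sup>2(\<Omega>)\<close>\<close>

definition L2_set_on :: "(real^'d) set \<Rightarrow> (real^'d \<Rightarrow> real) set" where
  "L2_set_on \<Omega> = {v. v \<in> borel_measurable (lebesgue_on \<Omega>) \<and>
                     integrable (lebesgue_on \<Omega>) (\<lambda>x. (v x)\<^sup>2)}"

definition L2_inner :: "(real^'d) set \<Rightarrow> (real^'d \<Rightarrow> real) \<Rightarrow> (real^'d \<Rightarrow> real) \<Rightarrow> real" where
  "L2_inner \<Omega> v w = (LINT x|lebesgue_on \<Omega>. v x * w x)"

definition L2_norm :: "(real^'d) set \<Rightarrow> (real^'d \<Rightarrow> real) \<Rightarrow> real" where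
  "L2_norm \<Omega> v = sqrt (L2_inner \<Omega> v v)"


section \<open>Tensor-product finite elements on a box\<close>

text \<open>Univariate continuous piecewise polynomials of degree at most \<open>r\<close> on the uniform partition
  of \<open>[lo, hi]\<close> into \<open>m\<close> cells, vanishing at both end points. Functions are extended by zero
  outside the interval, so that each of them is determined by its values on the interval.\<close>

definition fe_space_1d :: "real \<Rightarrow> real \<Rightarrow> nat \<Rightarrow> nat \<Rightarrow> (real \<Rightarrow> real) set" where
  "fe_space_1d lo hi m r =
     {g. continuous_on UNIV g \<and> (\<forall>y. y \<notin> {lo<..<hi} \<longrightarrow> g y = 0) \<and>
         (\<forall>i<m. \<exists>p :: real poly. degree p \<le> r \<and>
            (\<forall>y \<in> {lo + real i * ((hi - lo) / real m) .. lo + real (Suc i) * ((hi - lo) / real m)}.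
               g y = poly p y))}"

text \<open>The tensor product of the univariate spaces, i.e. the linear span of the products
  \<open>x \<mapsto> (\<Prod>k. g\<^sub>k(x\<^sub>k))\<close>; scalar coefficients can be absorbed into one of the factors.
  The box is \<open>\<Prod>k. (a\<^sub>k, b\<^sub>k)\<close> and \<open>m k\<close> is the number of cells in direction \<open>k\<close>.\<close>

definition fe_space :: "real^'d \<Rightarrow> real^'d \<Rightarrow> ('d \<Rightarrow> nat) \<Rightarrow> nat \<Rightarrow> (real^'d \<Rightarrow> real) set" where
  "fe_space a b m r =
     {v. \<exists>(L::nat) g. (\<forall>l<L. \<forall>k. g l k \<in> fe_space_1d (vec_nth a k) (vec_nth b k) (m k) r) \<and>
           v = (\<lambda>x. \<Sum>l<L. \<Prod>k\<in>UNIV. g l k (vec_nth x k))}"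

text \<open>The function with a given coefficient vector, i.e. the inverse of \<open>\<pi>\<^sub>h\<close>.\<close>

definition fe_fun :: "nat \<Rightarrow> (nat \<Rightarrow> real^'d \<Rightarrow> real) \<Rightarrow> real Matrix.vec \<Rightarrow> real^'d \<Rightarrow> real" where
  "fe_fun n \<phi> c = (\<lambda>x. \<Sum>i<n. vec_index c i * \<phi> i x)"

definition fe_basis ::
  "(real^'d \<Rightarrow> real) set \<Rightarrow> nat \<Rightarrow> (nat \<Rightarrow> real^'d \<Rightarrow> real) \<Rightarrow> bool" where
  "fe_basis V n \<phi> \<longleftrightarrow> bij_betw (fe_fun n \<phi>) (carrier_vec n) V"

definition fe_coeffs :: "nat \<Rightarrow> (nat \<Rightarrow> real^'d \<Rightarrow> real) \<Rightarrow> (real^'d \<Rightarrow> real) \<Rightarrow> real Matrix.vec" where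
  "fe_coeffs n \<phi> = the_inv_into (carrier_vec n) (fe_fun n \<phi>)"

definition mass_matrix :: "(real^'d) set \<Rightarrow> nat \<Rightarrow> (nat \<Rightarrow> real^'d \<Rightarrow> real) \<Rightarrow> real Matrix.mat" where
  "mass_matrix \<Omega> n \<phi> = Matrix.mat n n (\<lambda>(i, j). L2_inner \<Omega> (\<phi> j) (\<phi> i))"

text \<open>Finite element functions are not differentiable on the cell interfaces. These form a null
  set, on which the value of \<^term>\<open>deriv\<close> is irrelevant for the (complete) Lebesgue measure.\<close>

definition partial_deriv :: "'d \<Rightarrow> (real^'d \<Rightarrow> real) \<Rightarrow> real^'d \<Rightarrow> real" where
  "partial_deriv k v x = deriv (\<lambda>y. v (x + y *\<^sub>R axis k 1)) 0"

definition stiffness_matrix ::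
  "(real^'d) set \<Rightarrow> nat \<Rightarrow> (nat \<Rightarrow> real^'d \<Rightarrow> real) \<Rightarrow> real Matrix.mat" where
  "stiffness_matrix \<Omega> n \<phi> = Matrix.mat n n
     (\<lambda>(i, j). LINT x|lebesgue_on \<Omega>.
        (\<Sum>k\<in>UNIV. partial_deriv k (\<phi> j) x * partial_deriv k (\<phi> i) x))"


section \<open>Spectral fractional powers\<close>

text \<open>For a diagonalizable real matrix \<open>A = P D P\<^sup>-\<^sup>1\<close> the matrix \<open>P D\<^sup>s P\<^sup>-\<^sup>1\<close> does not depend on the
  choice of \<open>P\<close> and \<open>D\<close>. It is the spectral power if the eigenvalues are nonnegative.\<close>

definition spectral_power :: "real Matrix.mat \<Rightarrow> real \<Rightarrow> real Matrix.mat" where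
  "spectral_power A s =
     (THE B. \<exists>D P Q. similar_mat_wit A D P Q \<and> diagonal_mat D \<and>
             B = P * mat_diag (dim_row A) (\<lambda>i. (D $$ (i, i)) powr s) * Q)"

definition frac_laplace ::
  "(real^'d) set \<Rightarrow> nat \<Rightarrow> (nat \<Rightarrow> real^'d \<Rightarrow> real) \<Rightarrow> real \<Rightarrow> real \<Rightarrow>
   (real^'d \<Rightarrow> real) \<Rightarrow> (real^'d \<Rightarrow> real)" where
  "frac_laplace \<Omega> n \<phi> \<gamma> s v =
     fe_fun n \<phi>
       (spectral_power
          (the (mat_inverse (mass_matrix \<Omega> n \<phi>)) * stiffness_matrix \<Omega> n \<phi> + \<gamma> \<cdot>\<^sub>m 1\<^sub>m n) s
        *\<^sub>v fe_coeffs n \<phi> v)"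

definition frac_form ::
  "(real^'d) set \<Rightarrow> nat \<Rightarrow> (nat \<Rightarrow> real^'d \<Rightarrow> real) \<Rightarrow> real \<Rightarrow> real \<Rightarrow>
   (real^'d \<Rightarrow> real) \<Rightarrow> (real^'d \<Rightarrow> real) \<Rightarrow> real" where
  "frac_form \<Omega> n \<phi> \<gamma> s v w = L2_inner \<Omega> (frac_laplace \<Omega> n \<phi> \<gamma> s v) w"


section \<open>Time discretization\<close>

definition graded_mesh :: "real \<Rightarrow> nat \<Rightarrow> real \<Rightarrow> nat \<Rightarrow> real" where
  "graded_mesh T N \<omega> n = T * (real n / real N) powr \<omega>"

definition tstep :: "(nat \<Rightarrow> real) \<Rightarrow> nat \<Rightarrow> real" where
  "tstep t n = t n - t (n - 1)"

definition tau :: "real \<Rightarrow> (nat \<Rightarrow> real) \<Rightarrow> nat \<Rightarrow> real" where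
  "tau \<alpha> t n = tstep t n powr \<alpha> * Gamma (2 - \<alpha>)"

definition soe_dy :: "nat \<Rightarrow> real \<Rightarrow> real \<Rightarrow> real" where
  "soe_dy Q ymin ymax = (ymax - ymin) / (real Q - 1)"

definition soe_y :: "nat \<Rightarrow> real \<Rightarrow> real \<Rightarrow> nat \<Rightarrow> real" where
  "soe_y Q ymin ymax j = ymin + (real j - 1) * soe_dy Q ymin ymax"

definition soe_weight :: "real \<Rightarrow> nat \<Rightarrow> real \<Rightarrow> real \<Rightarrow> nat \<Rightarrow> real" where
  "soe_weight \<alpha> Q ymin ymax j =
     - (sin (\<alpha> * pi) / pi) * soe_dy Q ymin ymax * exp ((1 + \<alpha>) * soe_y Q ymin ymax j)"

definition soe_exponent :: "nat \<Rightarrow> real \<Rightarrow> real \<Rightarrow> nat \<Rightarrow> real" where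
  "soe_exponent Q ymin ymax j = - exp (soe_y Q ymin ymax j)"

text \<open>The history variable \<open>Y\<^sub>j\<close> for one exponent \<open>\<xi> = \<xi>\<^sub>j\<close>. Sequences \<open>\<rho>(t\<^sub>k)\<close> are indexed by \<open>k\<close>.\<close>

primrec history :: "(nat \<Rightarrow> real) \<Rightarrow> real \<Rightarrow> (nat \<Rightarrow> real) \<Rightarrow> nat \<Rightarrow> real" where
  "history t \<xi> \<rho> 0 = 0"
| "history t \<xi> \<rho> (Suc i) =
     (let z = \<xi> * tstep t (Suc i) in
        exp z * history t \<xi> \<rho> i
        + 1 / \<xi> * (exp z - 1 - (exp z - z - 1) / z) * \<rho> i
        + 1 / \<xi> * ((exp z - z - 1) / z) * \<rho> (Suc i))"

definition fast_caputo ::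
  "real \<Rightarrow> (nat \<Rightarrow> real) \<Rightarrow> nat \<Rightarrow> (nat \<Rightarrow> real) \<Rightarrow> (nat \<Rightarrow> real) \<Rightarrow> (nat \<Rightarrow> real) \<Rightarrow> nat \<Rightarrow> real" where
  "fast_caputo \<alpha> t Q w \<xi> \<rho> n =
     (\<rho> n - \<alpha> * \<rho> (n - 1) - (1 - \<alpha>) * (tstep t n / t n) powr \<alpha> * \<rho> 0) / tau \<alpha> t n
     + (\<Sum>j=1..Q. w j * exp (\<xi> j * tstep t n) * history t (\<xi> j) \<rho> (n - 1))"

text \<open>\<open>cbar \<beta> n k\<close> is the coefficient \<open>c\<^sub>n\<^sub>,\<^sub>k\<close> (with a bar) obtained from \<open>\<beta> n k = b\<^sub>k\<^sup>n\<close>, for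
  \<open>1 \<le> k \<le> n\<close>; the value at \<open>k = 0\<close> is a dummy.\<close>

primrec cbar :: "(nat \<Rightarrow> nat \<Rightarrow> real) \<Rightarrow> nat \<Rightarrow> nat \<Rightarrow> real" where
  "cbar \<beta> n 0 = 0"
| "cbar \<beta> n (Suc k) =
     (if Suc k = n then \<beta> n n else if k = 0 then - \<beta> n 0 else cbar \<beta> n k - \<beta> n k)"

text \<open>Only used for \<open>1 \<le> j \<le> n\<close>.\<close>

fun theta :: "real \<Rightarrow> (nat \<Rightarrow> real) \<Rightarrow> (nat \<Rightarrow> nat \<Rightarrow> real) \<Rightarrow> nat \<Rightarrow> nat \<Rightarrow> real" where
  "theta \<alpha> t c n j =
     (if n = j then 1
      else Gamma (2 - \<alpha>) *
           (\<Sum>k\<in>{j..<n}. tstep t k powr \<alpha> * theta \<alpha> t c k j * (c n (k + 1) - c n k)))"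

declare theta.simps [simp del]

end

theory Submission
  imports Defs "Jordan_Normal_Form.Jordan_Normal_Form_Existence"
begin

text \<open>The estimate is an energy argument. Testing the scheme at level \<open>n\<close> with \<open>v = u\<^sup>n\<close> leaves three
  terms. The fractional diffusion term is nonnegative and is dropped, and the source term is bounded by
  the Cauchy--Schwarz inequality. In the discrete time derivative, summation by parts gathers the
  increments \<open>c\<^sub>n\<^sub>,\<^sub>k\<^sub>+\<^sub>1 - c\<^sub>n\<^sub>,\<^sub>k\<close>, which are nonnegative, so that after division by \<open>\<parallel>u\<^sup>n\<parallel>\<close>
  \<open>c\<^sub>n\<^sub>,\<^sub>n \<parallel>u\<^sup>n\<parallel> \<le> c\<^sub>n\<^sub>,\<^sub>1 \<parallel>u\<^sup>0\<parallel> + (\<Sum>k=1..<n. (c\<^sub>n\<^sub>,\<^sub>k\<^sub>+\<^sub>1 - c\<^sub>n\<^sub>,\<^sub>k) \<parallel>u\<^sup>k\<parallel>) + \<parallel>f\<^sup>n\<parallel>\<close>.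
  The weights of \<open>\<parallel>u\<^sup>0\<parallel>\<close> and \<open>\<parallel>u\<^sup>k\<parallel>\<close> add up to \<open>c\<^sub>n\<^sub>,\<^sub>n\<close>. Hence the initial value enters
  the final bound with factor one, and \<open>\<theta>\<close> is exactly the kernel by which induction on \<open>n\<close>
  accumulates the sources (\<open>energy_step\<close> and \<open>discrete_fractional_Gronwall\<close>).

  What needs work is the sign of the diffusion term (\<open>frac_form_nonneg\<close>), because the fractional power
  is given through an arbitrary diagonalization \<open>A = P D P\<^sup>-\<^sup>1\<close> of \<open>A = M\<^sup>-\<^sup>1 S + \<gamma> I\<close> as a matrix. Since \<open>M A\<close>
  is symmetric and \<open>M\<close> is positive definite, \<open>A\<close> is self-adjoint for the inner product of \<open>M\<close>.
  This makes the eigenvalues real and all Jordan blocks trivial, so a diagonalization exists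
  (\<open>selfadjoint_diagonalizable\<close>), and the power is the same for all of them
  (\<open>diagonal_calculus_unique\<close>). In the coordinates given by \<open>P\<close> the inner product becomes
  \<open>G = P\<^sup>T M P\<close>, which commutes with \<open>D\<close>. Therefore \<open>G D\<^sup>s = E G E\<close> with \<open>E = D\<^sup>s\<^sup>/\<^sup>2\<close>, and the
  quadratic form of \<open>E G E\<close> is that of \<open>G\<close> evaluated at \<open>E y\<close> (\<open>spectral_power_form_nonneg\<close>).\<close>

section \<open>Symmetric positive definite matrices\<close>

definition spd_mat :: "nat \<Rightarrow> real Matrix.mat \<Rightarrow> bool" where
  "spd_mat n M \<longleftrightarrow> M \<in> carrier_mat n n \<and> transpose_mat M = M \<and>
     (\<forall>v\<in>carrier_vec n. v \<noteq> 0\<^sub>v n \<longrightarrow> 0 < scalar_prod v (M *\<^sub>v v))"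

lemma spd_mat_carrier: "spd_mat n M \<Longrightarrow> M \<in> carrier_mat n n"
  and spd_mat_symmetric: "spd_mat n M \<Longrightarrow> transpose_mat M = M"
  and spd_mat_pos: "spd_mat n M \<Longrightarrow> v \<in> carrier_vec n \<Longrightarrow> v \<noteq> 0\<^sub>v n \<Longrightarrow>
    0 < scalar_prod v (M *\<^sub>v v)"
  by (auto simp: spd_mat_def)

lemma spd_mat_nonneg:
  assumes "spd_mat n M" "v \<in> carrier_vec n"
  shows "0 \<le> scalar_prod v (M *\<^sub>v v)"
proof (cases "v = 0\<^sub>v n")
  case True
  then show ?thesis using spd_mat_carrier[OF assms(1)] by simp
next
  case False
  then show ?thesis using spd_mat_pos[OF assms] by simp
qed

lemma symmetric_mat_scalar_prod:
  assumes "(S :: real Matrix.mat) \<in> carrier_mat n n" "transpose_mat S = S"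
    and "x \<in> carrier_vec n" "y \<in> carrier_vec n"
  shows "scalar_prod x (S *\<^sub>v y) = scalar_prod y (S *\<^sub>v x)"
  using transpose_vec_mult_scalar[OF assms(1,4,3)] assms
  by (simp add: comm_scalar_prod[of _ n])

lemma spd_mat_inverse:
  assumes "spd_mat n M"
  obtains Mi where "mat_inverse M = Some Mi" "Mi \<in> carrier_mat n n"
    "M * Mi = 1\<^sub>m n" "Mi * M = 1\<^sub>m n"
proof -
  note M = spd_mat_carrier[OF assms]
  have "Determinant.det M \<noteq> 0"
  proof
    assume "Determinant.det M = 0"
    then obtain v where v: "v \<in> carrier_vec n" "v \<noteq> 0\<^sub>v n" "M *\<^sub>v v = 0\<^sub>v n"
      using det_0_iff_vec_prod_zero[OF M] by blast
    with spd_mat_pos[OF assms v(1,2)] show False by simp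
  qed
  then have "M \<in> Units (ring_mat TYPE(real) n ())" by (rule det_non_zero_imp_unit[OF M])
  then obtain Mi where "mat_inverse M = Some Mi"
    using mat_inverse(1)[OF M, where b = "()"] by (cases "mat_inverse M") auto
  with mat_inverse(2)[OF M this] show ?thesis using that by blast
qed

lemma congruence_scalar_prod:
  assumes M: "(M :: real Matrix.mat) \<in> carrier_mat n n" and P: "P \<in> carrier_mat n n"
    and v: "v \<in> carrier_vec n" and w: "w \<in> carrier_vec n"
  shows "scalar_prod v ((transpose_mat P * M * P) *\<^sub>v w)
      = scalar_prod (P *\<^sub>v v) (M *\<^sub>v (P *\<^sub>v w))"
proof -
  have "scalar_prod v (transpose_mat P *\<^sub>v (M *\<^sub>v (P *\<^sub>v w)))
      = scalar_prod (transpose_mat P *\<^sub>v (M *\<^sub>v (P *\<^sub>v w))) v"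
    using P M v w by (intro comm_scalar_prod[of _ n]) auto
  also have "\<dots> = scalar_prod (M *\<^sub>v (P *\<^sub>v w)) (P *\<^sub>v v)"
    using P M v w by (intro transpose_vec_mult_scalar) auto
  also have "\<dots> = scalar_prod (P *\<^sub>v v) (M *\<^sub>v (P *\<^sub>v w))"
    using P M v w by (intro comm_scalar_prod[of _ n]) auto
  finally show ?thesis using P M v w by (simp add: assoc_mult_mat_vec[of _ n n _ n])
qed

lemma symmetric_congruence:
  assumes S: "(S :: real Matrix.mat) \<in> carrier_mat n n" "transpose_mat S = S"
    and P: "P \<in> carrier_mat n n"
  shows "transpose_mat (transpose_mat P * S * P) = transpose_mat P * S * P"
  using S P by (simp add: transpose_mult[of _ n n _ n] assoc_mult_mat[of _ n n _ n _ n])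

lemma spd_mat_congruence:
  assumes "spd_mat n M" and P: "P \<in> carrier_mat n n" and Q: "Q \<in> carrier_mat n n"
    and QP: "Q * P = 1\<^sub>m n"
  shows "spd_mat n (transpose_mat P * M * P)"
proof -
  note M = spd_mat_carrier[OF assms(1)]
  have nonzero: "P *\<^sub>v v \<noteq> 0\<^sub>v n" if v: "v \<in> carrier_vec n" "v \<noteq> 0\<^sub>v n" for v
  proof
    assume "P *\<^sub>v v = 0\<^sub>v n"
    moreover have "Q *\<^sub>v 0\<^sub>v n = 0\<^sub>v n" using Q by (intro eq_vecI) auto
    ultimately have "(Q * P) *\<^sub>v v = 0\<^sub>v n" using P Q v by simp
    with QP v show False by simp
  qed
  show ?thesis
    unfolding spd_mat_def
  proof (intro conjI ballI impI)
    show "transpose_mat P * M * P \<in> carrier_mat n n" using M P by simp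
    show "transpose_mat (transpose_mat P * M * P) = transpose_mat P * M * P"
      by (rule symmetric_congruence[OF M spd_mat_symmetric[OF assms(1)] P])
    fix v :: "real Matrix.vec" assume v: "v \<in> carrier_vec n" "v \<noteq> 0\<^sub>v n"
    show "0 < scalar_prod v ((transpose_mat P * M * P) *\<^sub>v v)"
      unfolding congruence_scalar_prod[OF M P v(1) v(1)]
      using P v by (intro spd_mat_pos[OF assms(1)] nonzero) auto
  qed
qed

lemma spd_mat_diag_pos:
  assumes "spd_mat n G" "i < n"
  shows "0 < G $$ (i, i)"
proof -
  have "scalar_prod (unit_vec n i) (G *\<^sub>v unit_vec n i) = G $$ (i, i)"
    using spd_mat_carrier[OF assms(1)] assms(2) by (simp add: mult_mat_vec_def)
  then show ?thesis using spd_mat_pos[OF assms(1), of "unit_vec n i"] assms(2) by auto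
qed

section \<open>Diagonalization of self-adjoint matrices\<close>

text \<open>A complex eigenpair of a real matrix, split into real and imaginary parts. This form allows the reality of
  the eigenvalues to be proved with the real bilinear form of \<open>M\<close> alone.\<close>

lemma complex_eigenvalue_real_parts:
  assumes A: "A \<in> carrier_mat n n" and ev: "eigenvalue (map_mat complex_of_real A) l"
  obtains x y where "x \<in> carrier_vec n" "y \<in> carrier_vec n" "x \<noteq> 0\<^sub>v n \<or> y \<noteq> 0\<^sub>v n"
    "A *\<^sub>v x = Re l \<cdot>\<^sub>v x + (- Im l) \<cdot>\<^sub>v y" "A *\<^sub>v y = Re l \<cdot>\<^sub>v y + Im l \<cdot>\<^sub>v x"
proof -
  obtain v where v: "v \<in> carrier_vec n" "v \<noteq> 0\<^sub>v n"
      "map_mat complex_of_real A *\<^sub>v v = l \<cdot>\<^sub>v v"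
    using ev A by (auto simp: eigenvalue_def eigenvector_def)
  define x y where "x = map_vec Re v" and "y = map_vec Im v"
  have comp: "(\<Sum>j\<in>{0..<n}. complex_of_real (A $$ (i, j)) * vec_index v j) = l * vec_index v i"
    if "i < n" for i
    using arg_cong[OF v(3), of "\<lambda>u. vec_index u i"] that A v(1)
    by (simp add: scalar_prod_def)
  have "A *\<^sub>v x = Re l \<cdot>\<^sub>v x + (- Im l) \<cdot>\<^sub>v y"
  proof (rule eq_vecI)
    fix i assume "i < dim_vec (Re l \<cdot>\<^sub>v x + (- Im l) \<cdot>\<^sub>v y)"
    then have i: "i < n" using v(1) by (simp add: x_def y_def)
    show "vec_index (A *\<^sub>v x) i = vec_index (Re l \<cdot>\<^sub>v x + (- Im l) \<cdot>\<^sub>v y) i"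
      using arg_cong[OF comp[OF i], of Re] i A v(1) by (simp add: x_def y_def scalar_prod_def)
  qed (use A v(1) in \<open>simp add: y_def\<close>)
  moreover have "A *\<^sub>v y = Re l \<cdot>\<^sub>v y + Im l \<cdot>\<^sub>v x"
  proof (rule eq_vecI)
    fix i assume "i < dim_vec (Re l \<cdot>\<^sub>v y + Im l \<cdot>\<^sub>v x)"
    then have i: "i < n" using v(1) by (simp add: x_def y_def)
    show "vec_index (A *\<^sub>v y) i = vec_index (Re l \<cdot>\<^sub>v y + Im l \<cdot>\<^sub>v x) i"
      using arg_cong[OF comp[OF i], of Im] i A v(1) by (simp add: x_def y_def scalar_prod_def)
  qed (use A v(1) in \<open>simp add: x_def\<close>)
  moreover have "x \<noteq> 0\<^sub>v n \<or> y \<noteq> 0\<^sub>v n"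
  proof (rule ccontr)
    assume *: "\<not> (x \<noteq> 0\<^sub>v n \<or> y \<noteq> 0\<^sub>v n)"
    have "v = 0\<^sub>v n"
    proof (rule eq_vecI)
      fix i assume "i < dim_vec (0\<^sub>v n :: complex Matrix.vec)"
      then have i: "i < n" by simp
      have "vec_index x i = 0" "vec_index y i = 0" using * i by auto
      then show "vec_index v i = vec_index (0\<^sub>v n) i"
        using i v(1) by (simp add: x_def y_def complex_eq_iff)
    qed (use v(1) in simp)
    with v(2) show False by simp
  qed
  ultimately show ?thesis using that[of x y] v(1) by (simp add: x_def y_def)
qed

text \<open>If \<open>x + i y\<close> is an eigenvector for \<open>l\<close>, then comparing \<open>y\<^sup>T M A x\<close> with \<open>x\<^sup>T M A y\<close> gives
  \<open>Im l (x\<^sup>T M x + y\<^sup>T M y) = 0\<close>, and the bracket is positive.\<close>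

lemma selfadjoint_eigenvalue_real:
  assumes M: "spd_mat n M" and A: "A \<in> carrier_mat n n" and MA: "transpose_mat (M * A) = M * A"
    and ev: "eigenvalue (map_mat complex_of_real A) l"
  shows "Im l = 0"
proof -
  note Mc = spd_mat_carrier[OF M]
  obtain x y where x: "x \<in> carrier_vec n" and y: "y \<in> carrier_vec n"
      and ne: "x \<noteq> 0\<^sub>v n \<or> y \<noteq> 0\<^sub>v n"
      and Ax: "A *\<^sub>v x = Re l \<cdot>\<^sub>v x + (- Im l) \<cdot>\<^sub>v y" and Ay: "A *\<^sub>v y = Re l \<cdot>\<^sub>v y + Im l \<cdot>\<^sub>v x"
    using complex_eigenvalue_real_parts[OF A ev] by metis
  have lin: "scalar_prod z (M *\<^sub>v (p \<cdot>\<^sub>v x' + q \<cdot>\<^sub>v y'))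
      = p * scalar_prod z (M *\<^sub>v x') + q * scalar_prod z (M *\<^sub>v y')"
    if "z \<in> carrier_vec n" "x' \<in> carrier_vec n" "y' \<in> carrier_vec n" for z x' y' p q
    using that Mc by (simp add: mult_add_distrib_mat_vec[of _ n n] mult_mat_vec[of _ n n]
        scalar_prod_add_distrib[of _ n])
  have "scalar_prod y (M *\<^sub>v (A *\<^sub>v x)) = scalar_prod x (M *\<^sub>v (A *\<^sub>v y))"
    using symmetric_mat_scalar_prod[OF _ MA y x] Mc A x y
      by (simp add: assoc_mult_mat_vec[of _ n n _ n])
  moreover have "scalar_prod y (M *\<^sub>v x) = scalar_prod x (M *\<^sub>v y)"
    by (rule symmetric_mat_scalar_prod[OF Mc spd_mat_symmetric[OF M] y x])
  ultimately have "Im l * (scalar_prod x (M *\<^sub>v x) + scalar_prod y (M *\<^sub>v y)) = 0"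
    using x y by (simp add: Ax Ay lin algebra_simps)
  moreover have "0 < scalar_prod x (M *\<^sub>v x) + scalar_prod y (M *\<^sub>v y)"
    using ne spd_mat_pos[OF M x] spd_mat_pos[OF M y] spd_mat_nonneg[OF M x] spd_mat_nonneg[OF M y]
    by linarith
  ultimately show ?thesis by simp
qed

text \<open>The existence theorem for the Jordan normal form asks for linear factors over the base field. Over the
  complex numbers they exist, and the previous lemma says that all of them have real roots.\<close>

lemma selfadjoint_char_poly_splits:
  assumes M: "spd_mat n M" and A: "A \<in> carrier_mat n n" and MA: "transpose_mat (M * A) = M * A"
  shows "\<exists>as. char_poly A = (\<Prod>a\<leftarrow>as. [:- a, 1:])"
proof -
  define cA where "cA = map_mat complex_of_real A"
  have cA: "cA \<in> carrier_mat n n" using A by (simp add: cA_def)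
  obtain as where as: "char_poly cA = (\<Prod>a\<leftarrow>as. [:- a, 1:])"
    using char_poly_factorized[OF cA] by blast
  have "Im a = 0" if "a \<in> set as" for a
  proof -
    have "poly (char_poly cA) a = 0" unfolding as using that by (rule linear_poly_root)
    then show ?thesis
      using selfadjoint_eigenvalue_real[OF M A MA] eigenvalue_root_char_poly[OF cA] cA_def by blast
  qed
  then have re: "map (complex_of_real \<circ> Re) as = as"
    by (intro map_idI) (auto simp: complex_eq_iff)
  interpret mp: map_poly_inj_idom_hom complex_of_real ..
  have "map_poly complex_of_real (char_poly A) = char_poly cA"
    unfolding cA_def by (rule of_real_hom.char_poly_hom[OF A, symmetric])
  also have "\<dots> = (\<Prod>a\<leftarrow>map (complex_of_real \<circ> Re) as. [:- a, 1:])" by (simp add: re as)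
  also have "\<dots> = map_poly complex_of_real (\<Prod>a\<leftarrow>map Re as. [:- a, 1:])"
    by (induct as) (simp_all add: mp.hom_mult del: mult_pCons_left)
  finally show ?thesis
    unfolding mp.eq_iff by blast
qed


lemma jordan_matrix_off_diagonal:
  assumes "i < sum_list (map fst n_as)" "j < sum_list (map fst n_as)" "i \<noteq> j"
    and "jordan_matrix n_as $$ (i, j) \<noteq> 0"
  shows "j = Suc i \<and> jordan_matrix n_as $$ (i, j) = 1
    \<and> jordan_matrix n_as $$ (j, j) = jordan_matrix n_as $$ (i, i)"
  using assms
proof (induct n_as arbitrary: i j)
  case Nil
  then show ?case by simp
next
  case (Cons na n_as)
  obtain k a where na: "na = (k, a)" by (cases na)
  have "i < k \<longleftrightarrow> j < k"
    using Cons.prems by (auto simp: na jordan_matrix_Cons split: if_splits)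
  then consider "i < k" "j < k" | "k \<le> i" "k \<le> j" by linarith
  then show ?case
  proof cases
    case 1
    then show ?thesis using Cons.prems by (auto simp: na jordan_matrix_Cons split: if_splits)
  next
    case 2
    then have "i - k < sum_list (map fst n_as)" "j - k < sum_list (map fst n_as)"
        "i - k \<noteq> j - k" "jordan_matrix n_as $$ (i - k, j - k) \<noteq> 0"
      using Cons.prems by (auto simp: na jordan_matrix_Cons)
    note IH = Cons.hyps[OF this]
    then have "j = Suc i" using 2 by linarith
    with IH 2 Cons.prems(1-3) show ?thesis
      by (simp add: na jordan_matrix_Cons Suc_diff_le)
  qed
qed

text \<open>A nontrivial Jordan block starts with an eigenvector \<open>p\<close> and a vector \<open>q\<close> with \<open>(J - a) q = p\<close>. By
  self-adjointness \<open>\<langle>p, p\<rangle> = \<langle>(J - a) q, p\<rangle> = \<langle>q, (J - a) p\<rangle> = 0\<close>, which is impossible. With \<open>p\<close> and \<open>q\<close>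
  the unit vectors \<open>i\<close> and \<open>i + 1\<close>, this is a comparison of two entries of \<open>G J\<close>.\<close>

lemma symmetrizable_jordan_matrix_diagonal:
  assumes G: "spd_mat n G" and "jordan_matrix n_as \<in> carrier_mat n n"
    and "transpose_mat (G * jordan_matrix n_as) = G * jordan_matrix n_as"
  shows "diagonal_mat (jordan_matrix n_as)"
proof (rule ccontr)
  define J where "J = jordan_matrix n_as"
  note J = assms(2)[folded J_def] and sym = assms(3)[folded J_def]
  note Gc = spd_mat_carrier[OF G]
  have n: "n = sum_list (map fst n_as)" using assms(2) by (metis carrier_matD(1) jordan_matrix_dim(1))
  note off = jordan_matrix_off_diagonal[of _ n_as, folded n J_def]
  assume "\<not> diagonal_mat (jordan_matrix n_as)"
  then have "\<not> diagonal_mat J" by (simp add: J_def)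
  then obtain i0 j0 where "i0 < n" "j0 < n" "i0 \<noteq> j0" "J $$ (i0, j0) \<noteq> 0"
    using J by (auto simp: diagonal_mat_def)
  with off[of i0 j0] have ex: "\<exists>i. Suc i < n \<and> J $$ (i, Suc i) \<noteq> 0" by auto
  \<comment> \<open>The least such index is the start of a block, so that column \<open>i\<close> has only its diagonal entry.\<close>
  define i where "i = (LEAST i. Suc i < n \<and> J $$ (i, Suc i) \<noteq> 0)"
  from LeastI_ex[OF ex] have i: "Suc i < n" "J $$ (i, Suc i) \<noteq> 0" by (auto simp: i_def)
  have min: "J $$ (k, Suc k) = 0" if "k < i" for k
    using not_less_Least[OF that[unfolded i_def]] i(1) that by auto
  have col: "J $$ (k, i) = 0" if "k < n" "k \<noteq> i" for k
    using off[of k i] min[of k] that i(1) by fastforce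
  have col': "J $$ (k, Suc i) = 0" if "k < n" "k \<noteq> i" "k \<noteq> Suc i" for k
    using off[of k "Suc i"] that i(1) by fastforce
  have prod: "(G * J) $$ (p, q) = (\<Sum>k\<in>{0..<n}. G $$ (p, k) * J $$ (k, q))"
    if "p < n" "q < n" for p q
    using that Gc J by (simp add: scalar_prod_def)
  have "(G * J) $$ (Suc i, i) = (\<Sum>k\<in>{i}. G $$ (Suc i, k) * J $$ (k, i))"
    unfolding prod[OF i(1) Suc_lessD[OF i(1)]]
    using i(1) col by (intro sum.mono_neutral_right) auto
  moreover have "(G * J) $$ (i, Suc i) = (\<Sum>k\<in>{i, Suc i}. G $$ (i, k) * J $$ (k, Suc i))"
    unfolding prod[OF Suc_lessD[OF i(1)] i(1)]
    using i(1) col' by (intro sum.mono_neutral_right) auto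
  moreover have "(G * J) $$ (Suc i, i) = (G * J) $$ (i, Suc i)"
    using arg_cong[OF sym, of "\<lambda>B. B $$ (i, Suc i)"] Gc J i(1) by simp
  moreover have "G $$ (Suc i, i) = G $$ (i, Suc i)"
    using arg_cong[OF spd_mat_symmetric[OF G], of "\<lambda>B. B $$ (i, Suc i)"] Gc i(1) by simp
  ultimately have "G $$ (i, i) = 0" using off[of i "Suc i"] i by simp
  with spd_mat_diag_pos[OF G, of i] i(1) show False by simp
qed

text \<open>Self-adjointness does not depend on the basis: if \<open>A\<close> is self-adjoint for \<open>M\<close>, then its transform
  \<open>D = P\<^sup>-\<^sup>1 A P\<close> is self-adjoint for the transformed inner product \<open>P\<^sup>T M P\<close>.\<close>

lemma symmetrizable_similar:
  assumes M: "(M :: real Matrix.mat) \<in> carrier_mat n n" and A: "A \<in> carrier_mat n n"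
    and MA: "transpose_mat (M * A) = M * A" and wit: "similar_mat_wit A D P Q"
  shows "transpose_mat ((transpose_mat P * M * P) * D) = (transpose_mat P * M * P) * D"
proof -
  note w = similar_mat_witD2[OF A wit]
  note assoc = assoc_mult_mat[of _ n n _ n _ n]
  have "A * P = P * D * (Q * P)"
    by (subst w(3)) (use w(5-7) in \<open>simp add: assoc\<close>)
  also have "\<dots> = P * D" unfolding w(2) using w(5,6) by simp
  finally have AP: "A * P = P * D" .
  have "(transpose_mat P * M * P) * D = transpose_mat P * M * (P * D)"
    using w(5,6) M by (simp add: assoc)
  also have "\<dots> = transpose_mat P * (M * A) * P"
    unfolding AP[symmetric] using w(6) M A by (simp add: assoc)
  finally have "(transpose_mat P * M * P) * D = transpose_mat P * (M * A) * P" .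
  then show ?thesis
    using symmetric_congruence[OF _ MA w(6)] M A by simp
qed

theorem selfadjoint_diagonalizable:
  assumes M: "spd_mat n M" and A: "A \<in> carrier_mat n n" and MA: "transpose_mat (M * A) = M * A"
  obtains D P Q where "similar_mat_wit A D P Q" "diagonal_mat D"
proof -
  obtain n_as where "jordan_nf A n_as"
    using jordan_nf_exists[OF A] selfadjoint_char_poly_splits[OF assms] by blast
  then obtain P Q where wit: "similar_mat_wit A (jordan_matrix n_as) P Q"
    by (auto simp: jordan_nf_def similar_mat_def)
  note w = similar_mat_witD2[OF A wit]
  have "diagonal_mat (jordan_matrix n_as)"
    by (rule symmetrizable_jordan_matrix_diagonal[OF spd_mat_congruence[OF M w(6,7,2)] w(5)
          symmetrizable_similar[OF spd_mat_carrier[OF M] A MA wit]])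
  with wit show ?thesis by (rule that)
qed

section \<open>Spectral powers\<close>

lemma diagonal_mat_conv_mat_diag:
  assumes "diagonal_mat D" "D \<in> carrier_mat n n"
  shows "D = mat_diag n (\<lambda>i. D $$ (i, i))"
  using assms by (intro eq_matI) (auto simp: diagonal_mat_def mat_diag_def)


text \<open>The transition matrix \<open>R = Q P'\<close> satisfies \<open>D R = R D'\<close>. Its entry \<open>(i, j)\<close> can be nonzero only if
  the eigenvalues \<open>D\<^sub>i\<^sub>i\<close> and \<open>D'\<^sub>j\<^sub>j\<close> agree, hence \<open>R\<close> intertwines \<open>g D\<close> and \<open>g D'\<close> for every
  function \<open>g\<close>.\<close>

lemma diagonal_calculus_unique:
  fixes D D' :: "real Matrix.mat" and g :: "real \<Rightarrow> real"
  assumes A: "A \<in> carrier_mat n n"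
    and wit: "similar_mat_wit A D P Q" "diagonal_mat D"
    and wit': "similar_mat_wit A D' P' Q'" "diagonal_mat D'"
  shows "P * mat_diag n (\<lambda>i. g (D $$ (i, i))) * Q
       = P' * mat_diag n (\<lambda>i. g (D' $$ (i, i))) * Q'"
proof -
  note w = similar_mat_witD2[OF A wit(1)] and w' = similar_mat_witD2[OF A wit'(1)]
  define R where "R = Q * P'"
  let ?F = "mat_diag n (\<lambda>i. g (D $$ (i, i)))" and ?F' = "mat_diag n (\<lambda>i. g (D' $$ (i, i)))"
  note c [simp] = w(5,6,7) w'(5,6,7)
  have R [simp]: "R \<in> carrier_mat n n" unfolding R_def by (rule mult_carrier_mat[OF c(3,5)])
  note assoc = assoc_mult_mat[of _ n n _ n _ n] mult_carrier_mat[of _ n n _ n]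
  have "D * R = (Q * P) * D * R"
    unfolding w(2) using left_mult_one_mat[OF c(1)] by simp
  also have "\<dots> = Q * (P * D * Q) * P'" by (simp add: R_def assoc)
  also have "\<dots> = Q * (P' * D' * Q') * P'" using w(3) w'(3) by (simp only:)
  also have "\<dots> = R * D' * (Q' * P')" by (simp add: R_def assoc)
  also have "\<dots> = R * D'"
    unfolding w'(2) using right_mult_one_mat[OF mult_carrier_mat[OF R c(4)]] by simp
  finally have DR: "D * R = R * D'" .
  have entry: "D $$ (i, i) * R $$ (i, j) = R $$ (i, j) * D' $$ (j, j)" if "i < n" "j < n" for i j
  proof -
    have "(mat_diag n (\<lambda>i. D $$ (i, i)) * R) $$ (i, j)
        = (R * mat_diag n (\<lambda>i. D' $$ (i, i))) $$ (i, j)"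
      using DR diagonal_mat_conv_mat_diag[OF wit(2) c(1)]
        diagonal_mat_conv_mat_diag[OF wit'(2) c(4)] by simp
    then show ?thesis using that by (simp add: mat_diag_mult_left[OF R] mat_diag_mult_right[OF R])
  qed
  have FR: "?F * R = R * ?F'"
    unfolding mat_diag_mult_left[OF R] mat_diag_mult_right[OF R]
    using entry by (intro eq_matI) (auto, metis mult.commute mult_cancel_left)
  have "P * ?F * Q = P * ?F * (R * Q')"
    using w'(1) right_mult_one_mat[OF c(3)] by (simp add: R_def assoc)
  also have "\<dots> = P * (?F * R) * Q'" by (simp add: assoc)
  also have "\<dots> = (P * Q) * P' * ?F' * Q'" unfolding FR by (simp add: R_def assoc)
  also have "\<dots> = P' * ?F' * Q'"
    unfolding w(1) using left_mult_one_mat[OF c(5)] by simp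
  finally show ?thesis .
qed

lemma spectral_power_eq:
  assumes A: "A \<in> carrier_mat n n" and wit: "similar_mat_wit A D P Q" "diagonal_mat D"
  shows "spectral_power A s = P * mat_diag n (\<lambda>i. (D $$ (i, i)) powr s) * Q"
  unfolding spectral_power_def
proof (rule the_equality)
  show "\<exists>D' P' Q'. similar_mat_wit A D' P' Q' \<and> diagonal_mat D' \<and>
      P * mat_diag n (\<lambda>i. (D $$ (i, i)) powr s) * Q
      = P' * mat_diag (dim_row A) (\<lambda>i. (D' $$ (i, i)) powr s) * Q'"
    using wit A by auto
qed (use diagonal_calculus_unique[OF A _ _ wit, of _ _ _ "\<lambda>x. x powr s"] A in auto)

lemma spectral_power_carrier:
  assumes M: "spd_mat n M" and A: "A \<in> carrier_mat n n" and MA: "transpose_mat (M * A) = M * A"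
  shows "spectral_power A s \<in> carrier_mat n n"
proof -
  obtain D P Q where wit: "similar_mat_wit A D P Q" "diagonal_mat D"
    by (rule selfadjoint_diagonalizable[OF M A MA])
  then show ?thesis
    using similar_mat_witD2(6,7)[OF A wit(1)]
    by (simp add: spectral_power_eq[OF A wit] mult_carrier_mat[of _ n n _ n])
qed

text \<open>In the eigenbasis, \<open>G D = D G\<close> forces \<open>G\<^sub>i\<^sub>j = 0\<close> unless the eigenvalues \<open>i\<close> and \<open>j\<close> coincide. So the factor
  \<open>D\<^sub>j\<^sub>j\<^sup>s\<close> of \<open>G\<^sub>i\<^sub>j\<close> in \<open>G D\<^sup>s\<close> can be split evenly between the two sides as \<open>E G E\<close>. Real powers are nonnegative,
  so their square roots exist.\<close>

theorem spectral_power_form_nonneg: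
  assumes M: "spd_mat n M" and A: "A \<in> carrier_mat n n" and MA: "transpose_mat (M * A) = M * A"
    and v: "v \<in> carrier_vec n"
  shows "0 \<le> scalar_prod v (M *\<^sub>v (spectral_power A s *\<^sub>v v))"
proof -
  note Mc = spd_mat_carrier[OF M]
  obtain D P Q where wit: "similar_mat_wit A D P Q" "diagonal_mat D"
    by (rule selfadjoint_diagonalizable[OF M A MA])
  note w = similar_mat_witD2[OF A wit(1)]
  define G where "G = transpose_mat P * M * P"
  have G: "spd_mat n G" unfolding G_def by (rule spd_mat_congruence[OF M w(6,7,2)])
  note Gc = spd_mat_carrier[OF G]
  define F E where "F = mat_diag n (\<lambda>i. (D $$ (i, i)) powr s)"
    and "E = mat_diag n (\<lambda>i. sqrt ((D $$ (i, i)) powr s))"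
  have F: "F \<in> carrier_mat n n" and E: "E \<in> carrier_mat n n" by (simp_all add: F_def E_def)
  have ET: "transpose_mat E = E" unfolding E_def mat_diag_def by (intro eq_matI) auto
  have commute: "G $$ (i, j) = 0 \<or> D $$ (i, i) = D $$ (j, j)" if ij: "i < n" "j < n" for i j
  proof -
    have GD: "G * D = Matrix.mat n n (\<lambda>(i, j). G $$ (i, j) * D $$ (j, j))"
      using diagonal_mat_conv_mat_diag[OF wit(2) w(5)] mat_diag_mult_right[OF Gc] by metis
    have "(G * D) $$ (j, i) = (G * D) $$ (i, j)"
      using arg_cong[OF symmetrizable_similar[OF Mc A MA wit(1), folded G_def],
          of "\<lambda>B. B $$ (i, j)"] Gc w(5) ij by simp
    moreover have "G $$ (j, i) = G $$ (i, j)"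
      using arg_cong[OF spd_mat_symmetric[OF G], of "\<lambda>B. B $$ (i, j)"] Gc ij by simp
    ultimately show ?thesis using ij by (simp add: GD)
  qed
  have GF: "G * F = transpose_mat E * G * E"
  proof (rule eq_matI)
    fix i j assume "i < dim_row (transpose_mat E * G * E)" "j < dim_col (transpose_mat E * G * E)"
    then have ij: "i < n" "j < n" using E by auto
    have EG: "E * G \<in> carrier_mat n n" using E Gc by simp
    have "(E * G * E) $$ (i, j)
        = sqrt (D $$ (i, i) powr s) * G $$ (i, j) * sqrt (D $$ (j, j) powr s)"
      using ij mat_diag_mult_right[OF EG] mat_diag_mult_left[OF Gc] by (simp add: E_def)
    also have "\<dots> = G $$ (i, j) * D $$ (j, j) powr s"
      using commute[OF ij] by auto
    finally show "(G * F) $$ (i, j) = (transpose_mat E * G * E) $$ (i, j)"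
      using ij by (simp add: ET F_def mat_diag_mult_right[OF Gc])
  qed (use Gc E F in auto)
  define y where "y = Q *\<^sub>v v"
  have y: "y \<in> carrier_vec n" using w v by (simp add: y_def)
  have "P *\<^sub>v y = (P * Q) *\<^sub>v v"
    unfolding y_def by (rule assoc_mult_mat_vec[OF w(6,7) v, symmetric])
  also have "\<dots> = v" unfolding w(1) using v by simp
  finally have Py: "P *\<^sub>v y = v" .
  have "spectral_power A s *\<^sub>v v = P *\<^sub>v (F *\<^sub>v y)"
    using w(6,7) F v by (simp add: spectral_power_eq[OF A wit] F_def[symmetric] y_def
        assoc_mult_mat_vec[of _ n n _ n])
  then have "scalar_prod v (M *\<^sub>v (spectral_power A s *\<^sub>v v))
      = scalar_prod y (G *\<^sub>v (F *\<^sub>v y))"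
    using congruence_scalar_prod[OF Mc w(6) y, of "F *\<^sub>v y"] F y by (simp add: Py G_def)
  also have "\<dots> = scalar_prod y ((transpose_mat E * G * E) *\<^sub>v y)"
    using Gc F y by (simp add: GF[symmetric] assoc_mult_mat_vec[of _ n n _ n])
  also have "\<dots> = scalar_prod (E *\<^sub>v y) (G *\<^sub>v (E *\<^sub>v y))"
    by (rule congruence_scalar_prod[OF Gc E y y])
  also have "\<dots> \<ge> 0" using spd_mat_nonneg[OF G] E y by simp
  finally show ?thesis .
qed

section \<open>The inner product of square integrable functions\<close>

lemma box_continuous_integrable:
  fixes f :: "real^'d \<Rightarrow> real"
  assumes "continuous_on UNIV f"
  shows "integrable (lebesgue_on (box a b)) f"
proof -
  have "integrable (lebesgue_on (cbox a b)) f"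
    by (intro continuous_imp_integrable continuous_on_subset[OF assms]) auto
  then have "set_integrable lebesgue (cbox a b) f"
    by (simp add: set_integrable_def integrable_restrict_space)
  then have "set_integrable lebesgue (box a b) f"
    by (rule set_integrable_subset) (auto simp: box_subset_cbox)
  then show ?thesis by (simp add: set_integrable_def integrable_restrict_space)
qed

lemma continuous_in_L2_set_on_box:
  fixes v :: "real^'d \<Rightarrow> real"
  assumes "continuous_on UNIV v"
  shows "v \<in> L2_set_on (box a b)"
proof -
  have "v \<in> borel_measurable (lebesgue_on (box a b))"
    using continuous_on_subset[OF assms, of "box a b"]
    by (intro continuous_imp_measurable_on_sets_lebesgue) auto
  then show ?thesis
    using assms by (auto simp: L2_set_on_def intro!: box_continuous_integrable continuous_intros)
qed

lemma L2_mult_integrable: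
  assumes "v \<in> L2_set_on \<Omega>" "w \<in> L2_set_on \<Omega>"
  shows "integrable (lebesgue_on \<Omega>) (\<lambda>x. v x * w x)"
proof (rule Bochner_Integration.integrable_bound)
  show "integrable (lebesgue_on \<Omega>) (\<lambda>x. (v x)\<^sup>2 + (w x)\<^sup>2)"
    using assms by (auto simp: L2_set_on_def)
  show "(\<lambda>x. v x * w x) \<in> borel_measurable (lebesgue_on \<Omega>)"
    using assms by (auto simp: L2_set_on_def)
  have "\<bar>p * q\<bar> \<le> p\<^sup>2 + q\<^sup>2" for p q :: real
  proof -
    have "2 * \<bar>p * q\<bar> \<le> p\<^sup>2 + q\<^sup>2"
      using sum_squares_bound[of "\<bar>p\<bar>" "\<bar>q\<bar>"] by (simp add: abs_mult)
    then show ?thesis using abs_ge_zero[of "p * q"] by linarith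
  qed
  then show "AE x in lebesgue_on \<Omega>. norm (v x * w x) \<le> norm ((v x)\<^sup>2 + (w x)\<^sup>2)"
    by simp
qed

lemma L2_inner_self_nonneg: "0 \<le> L2_inner \<Omega> v v"
  unfolding L2_inner_def by (rule Bochner_Integration.integral_nonneg) simp

lemma L2_norm_power2: "(L2_norm \<Omega> v)\<^sup>2 = L2_inner \<Omega> v v"
  by (simp add: L2_norm_def L2_inner_self_nonneg)

lemma L2_norm_nonneg: "0 \<le> L2_norm \<Omega> v"
  by (simp add: L2_norm_def L2_inner_self_nonneg)

text \<open>The quadratic form \<open>\<parallel>p v + q w\<parallel>\<^sup>2\<close> in \<open>(p, q)\<close> is nonnegative, so its discriminant is not positive.\<close>

lemma L2_Cauchy_Schwarz:
  assumes v: "v \<in> L2_set_on \<Omega>" and w: "w \<in> L2_set_on \<Omega>"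
  shows "\<bar>L2_inner \<Omega> v w\<bar> \<le> L2_norm \<Omega> v * L2_norm \<Omega> w"
proof -
  note int = L2_mult_integrable[OF v v] L2_mult_integrable[OF v w] L2_mult_integrable[OF w w]
  have quad: "0 \<le> p\<^sup>2 * L2_inner \<Omega> v v + 2 * p * q * L2_inner \<Omega> v w + q\<^sup>2 * L2_inner \<Omega> w w"
    for p q
  proof -
    have "0 \<le> (LINT x|lebesgue_on \<Omega>. (p * v x + q * w x)\<^sup>2)"
      by (rule Bochner_Integration.integral_nonneg) simp
    also have "\<dots> = (LINT x|lebesgue_on \<Omega>.
        p\<^sup>2 * (v x * v x) + 2 * p * q * (v x * w x) + q\<^sup>2 * (w x * w x))"
      by (rule Bochner_Integration.integral_cong) (auto simp: power2_eq_square algebra_simps)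
    also have "\<dots> = p\<^sup>2 * L2_inner \<Omega> v v + 2 * p * q * L2_inner \<Omega> v w + q\<^sup>2 * L2_inner \<Omega> w w"
      using int by (simp add: L2_inner_def)
    finally show ?thesis .
  qed
  have "(L2_inner \<Omega> v w)\<^sup>2 \<le> L2_inner \<Omega> v v * L2_inner \<Omega> w w"
  proof (cases "L2_inner \<Omega> w w = 0")
    case True
    have "L2_inner \<Omega> v w = 0"
    proof (rule ccontr)
      assume nz: "L2_inner \<Omega> v w \<noteq> 0"
      show False
        \<comment> \<open>The form is now affine in \<open>q\<close>; this \<open>q\<close> gives it the value \<open>-1\<close>.\<close>
        using quad[of 1 "- (L2_inner \<Omega> v v + 1) / (2 * L2_inner \<Omega> v w)"] nz True
        by (simp add: field_simps)
    qed
    with True show ?thesis by simp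
  next
    case False
    then have pos: "0 < L2_inner \<Omega> w w" using L2_inner_self_nonneg[of \<Omega> w] by simp
    have "0 \<le> L2_inner \<Omega> w w * (L2_inner \<Omega> v v * L2_inner \<Omega> w w - (L2_inner \<Omega> v w)\<^sup>2)"
      using quad[of "L2_inner \<Omega> w w" "- L2_inner \<Omega> v w"]
      by (simp add: power2_eq_square algebra_simps)
    with pos show ?thesis by (simp add: zero_le_mult_iff)
  qed
  then have "(L2_inner \<Omega> v w)\<^sup>2 \<le> (L2_norm \<Omega> v * L2_norm \<Omega> w)\<^sup>2"
    by (simp add: power_mult_distrib L2_norm_power2)
  then show ?thesis
    by (simp add: L2_norm_nonneg abs_le_square_iff[symmetric])
qed

section \<open>The finite element operator\<close>

lemma fe_space_continuous:
  assumes "v \<in> fe_space a b m r"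
  shows "continuous_on UNIV v"
proof -
  obtain L :: nat and g where g: "\<And>l k. l < L \<Longrightarrow> g l k \<in> fe_space_1d (vec_nth a k) (vec_nth b k) (m k) r"
      and v: "v = (\<lambda>x. \<Sum>l<L. \<Prod>k\<in>UNIV. g l k (vec_nth x k))"
    using assms by (auto simp: fe_space_def)
  have "continuous_on UNIV (\<lambda>x. g l k (vec_nth x k))" if "l < L" for l k
  proof -
    have "continuous_on UNIV (g l k)" using g[OF that, of k] by (simp add: fe_space_1d_def)
    then show ?thesis
      by (rule continuous_on_compose2) (auto intro!: continuous_intros)
  qed
  then show ?thesis
    unfolding v by (intro continuous_on_sum continuous_on_prod) auto
qed

lemma fe_space_vanishes:
  assumes "v \<in> fe_space a b m r" "x \<notin> box a b"
  shows "v x = 0"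
proof -
  obtain L :: nat and g where g: "\<And>l k. l < L \<Longrightarrow> g l k \<in> fe_space_1d (vec_nth a k) (vec_nth b k) (m k) r"
      and v: "v = (\<lambda>x. \<Sum>l<L. \<Prod>k\<in>UNIV. g l k (vec_nth x k))"
    using assms by (auto simp: fe_space_def)
  obtain k where k: "vec_nth x k \<notin> {vec_nth a k<..<vec_nth b k}"
    using assms(2) by (auto simp: mem_box_cart)
  have "(\<Prod>k\<in>UNIV. g l k (vec_nth x k)) = 0" if "l < L" for l
    using g[OF that, of k] k by (intro prod_zero bexI[of _ k]) (auto simp: fe_space_1d_def)
  then show ?thesis unfolding v by (intro sum.neutral) auto
qed

text \<open>The integral over the box determines a continuous function only inside the box. Outside it, finite element
  functions are zero by definition, so equality holds everywhere, as the injectivity of \<open>fe_fun\<close> requires.\<close>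

lemma fe_space_L2_definite:
  assumes v: "v \<in> fe_space a b m r" and zero: "L2_inner (box a b) v v = 0"
  shows "v = (\<lambda>x. 0)"
proof (rule ext)
  fix x
  have cont: "continuous_on UNIV (\<lambda>x. v x * v x)"
    using fe_space_continuous[OF v] by (intro continuous_intros)
  show "v x = 0"
  proof (cases "x \<in> box a b")
    case True
    have "integral (cbox a b) (\<lambda>x. v x * v x) = integral (box a b) (\<lambda>x. v x * v x)"
      by (simp add: integral_open_interval)
    also have "\<dots> = L2_inner (box a b) v v"
      unfolding L2_inner_def
      by (rule lebesgue_integral_eq_integral[symmetric]) (simp_all add: box_continuous_integrable cont)
    finally have "integral (cbox a b) (\<lambda>x. v x * v x) = 0" using zero by simp
    moreover have "box a b \<noteq> {}" using True by blast
    ultimately have "\<forall>x\<in>cbox a b. v x * v x = 0"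
      using integral_cbox_eq_0_iff[of a b "\<lambda>x. v x * v x"] continuous_on_subset[OF cont] by auto
    then show ?thesis using True box_subset_cbox by auto
  next
    case False
    then show ?thesis by (rule fe_space_vanishes[OF v])
  qed
qed

lemma fe_basis_function_in_space:
  assumes "fe_basis V n \<phi>" "i < n"
  shows "\<phi> i \<in> V"
proof -
  have "fe_fun n \<phi> (unit_vec n i) x = \<phi> i x" for x
    using assms(2) by (simp add: fe_fun_def unit_vec_def if_distrib[of "\<lambda>t. t * _"] cong: if_cong)
  then have "\<phi> i = fe_fun n \<phi> (unit_vec n i)" by auto
  then show ?thesis using assms by (auto simp: fe_basis_def bij_betw_def)
qed

lemma fe_fun_in_space:
  assumes "fe_basis V n \<phi>" "c \<in> carrier_vec n"
  shows "fe_fun n \<phi> c \<in> V"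
  using assms by (auto simp: fe_basis_def bij_betw_def)

lemma fe_coeffs:
  assumes "fe_basis V n \<phi>" "v \<in> V"
  shows "fe_coeffs n \<phi> v \<in> carrier_vec n" "fe_fun n \<phi> (fe_coeffs n \<phi> v) = v"
  using assms the_inv_into_into[of "fe_fun n \<phi>" "carrier_vec n" v "carrier_vec n"]
    f_the_inv_into_f[of "fe_fun n \<phi>" "carrier_vec n" v]
  by (auto simp: fe_basis_def fe_coeffs_def bij_betw_def)

lemma L2_inner_fe_fun:
  assumes \<phi>: "\<And>i. i < n \<Longrightarrow> \<phi> i \<in> L2_set_on \<Omega>"
    and c: "c \<in> carrier_vec n" and d: "d \<in> carrier_vec n"
  shows "L2_inner \<Omega> (fe_fun n \<phi> c) (fe_fun n \<phi> d) = scalar_prod d (mass_matrix \<Omega> n \<phi> *\<^sub>v c)"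
proof -
  have "L2_inner \<Omega> (fe_fun n \<phi> c) (fe_fun n \<phi> d)
      = (LINT x|lebesgue_on \<Omega>. (\<Sum>i<n. \<Sum>j<n. (vec_index d i * vec_index c j) * (\<phi> j x * \<phi> i x)))"
    unfolding L2_inner_def fe_fun_def sum_product
    by (subst sum.swap) (simp add: mult_ac)
  also have "\<dots> = (\<Sum>i<n. \<Sum>j<n. (vec_index d i * vec_index c j) * L2_inner \<Omega> (\<phi> j) (\<phi> i))"
    unfolding L2_inner_def using L2_mult_integrable[OF \<phi> \<phi>]
    by (subst Bochner_Integration.integral_sum Bochner_Integration.integrable_sum; simp)+
  also have "\<dots> = scalar_prod d (mass_matrix \<Omega> n \<phi> *\<^sub>v c)"
    using c d by (simp add: scalar_prod_def mass_matrix_def sum_distrib_left atLeast0LessThan mult_ac)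
  finally show ?thesis .
qed

lemma stiffness_matrix_symmetric: "transpose_mat (stiffness_matrix \<Omega> n \<phi>) = stiffness_matrix \<Omega> n \<phi>"
  by (intro eq_matI) (auto simp: stiffness_matrix_def mult.commute)

lemma L2_inner_sum_left:
  assumes "\<And>k. k \<in> K \<Longrightarrow> g k \<in> L2_set_on \<Omega>" "w \<in> L2_set_on \<Omega>"
  shows "L2_inner \<Omega> (\<lambda>x. \<Sum>k\<in>K. p k * g k x) w = (\<Sum>k\<in>K. p k * L2_inner \<Omega> (g k) w)"
proof -
  have "L2_inner \<Omega> (\<lambda>x. \<Sum>k\<in>K. p k * g k x) w
      = (LINT x|lebesgue_on \<Omega>. (\<Sum>k\<in>K. p k * (g k x * w x)))"
    unfolding L2_inner_def by (simp add: sum_distrib_right mult.assoc)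
  then show ?thesis using L2_mult_integrable[OF assms(1) assms(2)] by (simp add: L2_inner_def)
qed


lemma L2_inner_diff_left:
  assumes "u \<in> L2_set_on \<Omega>" "v \<in> L2_set_on \<Omega>" "w \<in> L2_set_on \<Omega>"
  shows "L2_inner \<Omega> (\<lambda>x. u x - v x) w = L2_inner \<Omega> u w - L2_inner \<Omega> v w"
  using L2_mult_integrable[OF assms(1,3)] L2_mult_integrable[OF assms(2,3)]
  by (simp add: L2_inner_def left_diff_distrib)

lemma mass_matrix_spd:
  assumes basis: "fe_basis (fe_space a b m r) n \<phi>"
  shows "spd_mat n (mass_matrix (box a b) n \<phi>)"
proof -
  let ?\<Omega> = "box a b"
  let ?M = "mass_matrix ?\<Omega> n \<phi>"
  have L2: "\<phi> i \<in> L2_set_on ?\<Omega>" if "i < n" for i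
    using fe_basis_function_in_space[OF basis that]
    by (intro continuous_in_L2_set_on_box fe_space_continuous)
  have pos: "0 < scalar_prod c (?M *\<^sub>v c)" if c: "c \<in> carrier_vec n" "c \<noteq> 0\<^sub>v n" for c
  proof -
    have inner: "scalar_prod c (?M *\<^sub>v c) = L2_inner ?\<Omega> (fe_fun n \<phi> c) (fe_fun n \<phi> c)"
      by (rule L2_inner_fe_fun[OF L2 c(1) c(1), symmetric])
    have "fe_fun n \<phi> c \<noteq> fe_fun n \<phi> (0\<^sub>v n)"
      using basis c by (auto simp: fe_basis_def bij_betw_def dest: inj_onD)
    then have "fe_fun n \<phi> c \<noteq> (\<lambda>x. 0)" by (simp add: fe_fun_def)
    then have "L2_inner ?\<Omega> (fe_fun n \<phi> c) (fe_fun n \<phi> c) \<noteq> 0"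
      using fe_space_L2_definite[OF fe_fun_in_space[OF basis c(1)]] by blast
    then show ?thesis unfolding inner
      using L2_inner_self_nonneg[of ?\<Omega> "fe_fun n \<phi> c"] by simp
  qed
  have "transpose_mat ?M = ?M"
    by (intro eq_matI) (auto simp: mass_matrix_def L2_inner_def mult.commute)
  then show ?thesis using pos by (auto simp: spd_mat_def mass_matrix_def)
qed

text \<open>Multiplication by \<open>M\<close> cancels the inverse: \<open>M (M\<^sup>-\<^sup>1 S + \<gamma> I) = S + \<gamma> M\<close>.\<close>

lemma discrete_laplacian_selfadjoint:
  fixes \<gamma> :: real
  assumes M: "spd_mat n M" and S: "S \<in> carrier_mat n n" "transpose_mat S = S"
  defines "A \<equiv> the (mat_inverse M) * S + \<gamma> \<cdot>\<^sub>m 1\<^sub>m n"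
  shows "A \<in> carrier_mat n n" "transpose_mat (M * A) = M * A"
proof -
  note Mc = spd_mat_carrier[OF M]
  obtain Mi where Mi: "mat_inverse M = Some Mi" "Mi \<in> carrier_mat n n" "M * Mi = 1\<^sub>m n"
    by (rule spd_mat_inverse[OF M])
  have A: "A = Mi * S + \<gamma> \<cdot>\<^sub>m 1\<^sub>m n" by (simp add: A_def Mi(1))
  show "A \<in> carrier_mat n n" using Mi(2) S(1) by (simp add: A)
  have "M * A = M * (Mi * S) + M * (\<gamma> \<cdot>\<^sub>m 1\<^sub>m n)"
    unfolding A using Mc Mi(2) S(1) by (intro mult_add_distrib_mat) auto
  also have "M * (Mi * S) = (M * Mi) * S"
    by (rule assoc_mult_mat[OF Mc Mi(2) S(1), symmetric])
  also have "\<dots> = S" unfolding Mi(3) by (rule left_mult_one_mat[OF S(1)])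
  also have "M * (\<gamma> \<cdot>\<^sub>m 1\<^sub>m n) = \<gamma> \<cdot>\<^sub>m (M * 1\<^sub>m n)"
    by (rule mult_smult_distrib[OF Mc one_carrier_mat])
  also have "M * 1\<^sub>m n = M" by (rule right_mult_one_mat[OF Mc])
  finally have MA: "M * A = S + \<gamma> \<cdot>\<^sub>m M" .
  have "transpose_mat (S + \<gamma> \<cdot>\<^sub>m M) = transpose_mat S + \<gamma> \<cdot>\<^sub>m transpose_mat M"
    using S(1) Mc by (intro eq_matI) auto
  then show "transpose_mat (M * A) = M * A"
    by (simp add: MA S(2) spd_mat_symmetric[OF M])
qed

text \<open>The Gram matrix \<open>M\<close> carries the \<open>L\<^sup>2\<close> inner product over to coefficient vectors, where the form becomes the
  quadratic form of \<open>M A\<^sup>s\<close>.\<close>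

theorem frac_form_nonneg:
  assumes basis: "fe_basis (fe_space a b m r) n \<phi>" and v: "v \<in> fe_space a b m r"
  shows "0 \<le> frac_form (box a b) n \<phi> \<gamma> s v v"
proof -
  let ?\<Omega> = "box a b"
  let ?M = "mass_matrix ?\<Omega> n \<phi>" and ?S = "stiffness_matrix ?\<Omega> n \<phi>"
  define A where "A = the (mat_inverse ?M) * ?S + \<gamma> \<cdot>\<^sub>m 1\<^sub>m n"
  define c where "c = fe_coeffs n \<phi> v"
  have c: "c \<in> carrier_vec n" "fe_fun n \<phi> c = v"
    using fe_coeffs[OF basis v] by (simp_all add: c_def)
  have L2: "\<phi> i \<in> L2_set_on ?\<Omega>" if "i < n" for i
    using fe_basis_function_in_space[OF basis that]
    by (intro continuous_in_L2_set_on_box fe_space_continuous)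
  note M = mass_matrix_spd[OF basis]
  have S: "?S \<in> carrier_mat n n" by (simp add: stiffness_matrix_def)
  note A = discrete_laplacian_selfadjoint[OF M S stiffness_matrix_symmetric, of \<gamma>, folded A_def]
  have pw: "spectral_power A s *\<^sub>v c \<in> carrier_vec n"
    by (rule mult_mat_vec_carrier[OF spectral_power_carrier[OF M A] c(1)])
  have "frac_form ?\<Omega> n \<phi> \<gamma> s v v
      = L2_inner ?\<Omega> (fe_fun n \<phi> (spectral_power A s *\<^sub>v c)) (fe_fun n \<phi> c)"
    by (simp add: frac_form_def frac_laplace_def A_def c_def[symmetric] c(2))
  also have "\<dots> = scalar_prod c (?M *\<^sub>v (spectral_power A s *\<^sub>v c))"
    by (rule L2_inner_fe_fun[OF L2 pw c(1)])
  also have "\<dots> \<ge> 0" by (rule spectral_power_form_nonneg[OF M A c(1)])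
  finally show ?thesis .
qed

section \<open>Discrete time derivative\<close>

lemma cbar_diagonal: "1 \<le> n \<Longrightarrow> cbar \<beta> n n = \<beta> n n"
  by (cases n) auto

lemma history_eq_0: "(\<And>k. k \<le> i \<Longrightarrow> \<rho> k = 0) \<Longrightarrow> history t \<xi> \<rho> i = 0"
  by (induct i) (auto simp: Let_def)

text \<open>The coefficient of \<open>\<rho>(t\<^sub>n)\<close> is found by inserting the sequence that is \<open>1\<close> at \<open>n\<close> and \<open>0\<close> elsewhere: the history
  variables stop at \<open>t\<^sub>n\<^sub>-\<^sub>1\<close> and do not see it.\<close>

lemma cbar_leading_coefficient:
  assumes n: "1 \<le> n"
    and coeffs: "\<And>\<rho>. (\<Sum>k=0..n. \<beta> n k * \<rho> k) = fast_caputo \<alpha> t Q w \<xi> \<rho> n"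
  shows "cbar \<beta> n n = 1 / tau \<alpha> t n"
proof -
  define \<rho> :: "nat \<Rightarrow> real" where "\<rho> = (\<lambda>k. if k = n then 1 else 0)"
  have "history t x \<rho> (n - 1) = 0" for x
    using n by (intro history_eq_0) (auto simp: \<rho>_def)
  then have "fast_caputo \<alpha> t Q w \<xi> \<rho> n = 1 / tau \<alpha> t n"
    using n by (simp add: fast_caputo_def \<rho>_def)
  moreover have "(\<Sum>k=0..n. \<beta> n k * \<rho> k) = \<beta> n n"
    by (simp add: \<rho>_def if_distrib[of "\<lambda>t. _ * t"] cong: if_cong)
  ultimately show ?thesis using coeffs[of \<rho>] cbar_diagonal[OF n] by metis
qed

lemma sum_by_parts_increments:
  fixes p g :: "nat \<Rightarrow> real"
  assumes "1 \<le> n"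
  shows "(\<Sum>k=1..n. p k * (g k - g (k - 1)))
    = p n * g n - p 1 * g 0 - (\<Sum>k=1..<n. (p (k + 1) - p k) * g k)"
  using assms
proof (induct n rule: dec_induct)
  case base
  then show ?case by (simp add: algebra_simps)
next
  case (step n)
  then show ?case by (simp add: sum.atLeastLessThan_Suc algebra_simps)
qed

lemma sum_increments:
  fixes p :: "nat \<Rightarrow> real"
  assumes "1 \<le> n"
  shows "(\<Sum>k=1..<n. p (k + 1) - p k) = p n - p 1"
  using sum_by_parts_increments[OF assms, of p "\<lambda>_. 1"] by simp

text \<open>Here \<open>g k\<close> stands for the inner product of \<open>u\<^sup>k\<close> with \<open>u\<^sup>n\<close>, \<open>U k\<close> for the norm of \<open>u\<^sup>k\<close> and \<open>p\<close> for the row \<open>n\<close> of the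
  coefficients. After summation by parts every weight is nonnegative, so that Cauchy--Schwarz applies term
  by term and a factor \<open>U n\<close> cancels.\<close>

lemma energy_step:
  fixes p g U :: "nat \<Rightarrow> real"
  assumes n: "1 \<le> n" and U: "\<And>k. 0 \<le> U k" and F: "0 \<le> F"
    and g: "\<And>k. k < n \<Longrightarrow> \<bar>g k\<bar> \<le> U k * U n" and gn: "g n = (U n)\<^sup>2"
    and p1: "0 \<le> p 1" and p: "\<And>k. k \<in> {1..<n} \<Longrightarrow> p k \<le> p (k + 1)"
    and energy: "(\<Sum>k=1..n. p k * (g k - g (k - 1))) \<le> F * U n"
  shows "p n * U n \<le> p 1 * U 0 + (\<Sum>k=1..<n. (p (k + 1) - p k) * U k) + F"
    (is "_ \<le> ?R")
proof (cases "U n = 0")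
  case True
  have "0 \<le> (\<Sum>k=1..<n. (p (k + 1) - p k) * U k)"
    using p U by (intro sum_nonneg mult_nonneg_nonneg) auto
  then show ?thesis using True p1 U[of 0] F by simp
next
  case False
  then have pos: "0 < U n" using U[of n] by simp
  have "p n * (U n)\<^sup>2 \<le> p 1 * g 0 + (\<Sum>k=1..<n. (p (k + 1) - p k) * g k) + F * U n"
    using energy unfolding sum_by_parts_increments[OF n, of p g] gn by linarith
  also have "\<dots> \<le> p 1 * (U 0 * U n) + (\<Sum>k=1..<n. (p (k + 1) - p k) * (U k * U n)) + F * U n"
  proof (intro add_mono sum_mono mult_left_mono)
    show "g 0 \<le> U 0 * U n" using g[of 0] n by linarith
    show "0 \<le> p 1" by (rule p1)
    show "g k \<le> U k * U n" if "k \<in> {1..<n}" for k using g[of k] that by auto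
    show "0 \<le> p (k + 1) - p k" if "k \<in> {1..<n}" for k using p[OF that] by simp
  qed (simp_all add: F)
  also have "\<dots> = ?R * U n"
    by (simp add: algebra_simps sum_distrib_left)
  finally have "p n * U n * U n \<le> ?R * U n" by (simp add: power2_eq_square mult.assoc)
  with pos show ?thesis by simp
qed

lemma theta_recursion:
  assumes "j < n"
  shows "theta \<alpha> t c n j = (\<Sum>k=j..<n. (c n (k + 1) - c n k) * (tau \<alpha> t k * theta \<alpha> t c k j))"
  using assms by (subst theta.simps) (simp add: tau_def sum_distrib_left mult_ac)

text \<open>Induction on \<open>n\<close>: inserting the bounds for \<open>U k\<close>, \<open>k < n\<close>, the multiples of \<open>U 0\<close> telescope to \<open>c\<^sub>n\<^sub>,\<^sub>n U 0\<close>. In the double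
  sum of source terms, exchanging the order of summation over \<open>j \<le> k < n\<close> produces the recursion of \<open>\<theta>\<close>.\<close>

lemma discrete_fractional_Gronwall:
  fixes U F :: "nat \<Rightarrow> real" and c :: "nat \<Rightarrow> nat \<Rightarrow> real"
  assumes mono: "\<And>n k. n \<in> {1..N} \<Longrightarrow> k \<in> {1..<n} \<Longrightarrow> c n k \<le> c n (k + 1)"
    and pos: "\<And>n. n \<in> {1..N} \<Longrightarrow> 0 < c n n"
    and tau: "\<And>n. n \<in> {1..N} \<Longrightarrow> c n n = 1 / tau \<alpha> t n"
    and step: "\<And>n. n \<in> {1..N} \<Longrightarrow>
      c n n * U n \<le> c n 1 * U 0 + (\<Sum>k=1..<n. (c n (k + 1) - c n k) * U k) + F n"
    and "n \<in> {1..N}"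
  shows "U n \<le> U 0 + 1 / c n n * (\<Sum>j=1..n. theta \<alpha> t c n j * F j)"
  using \<open>n \<in> {1..N}\<close>
proof (induct n rule: less_induct)
  case (less n)
  let ?d = "\<lambda>k. c n (k + 1) - c n k" and ?\<theta> = "theta \<alpha> t c"
  have n: "1 \<le> n" using less.prems by simp
  have IH: "U k \<le> U 0 + tau \<alpha> t k * (\<Sum>j=1..k. ?\<theta> k j * F j)" if "k \<in> {1..<n}" for k
    using less.hyps[of k] tau[of k] that less.prems by simp
  have "(\<Sum>k=1..<n. ?d k * U k)
      \<le> (\<Sum>k=1..<n. ?d k * (U 0 + tau \<alpha> t k * (\<Sum>j=1..k. ?\<theta> k j * F j)))"
    using IH mono[OF less.prems] by (intro sum_mono mult_left_mono) auto
  also have "\<dots> = (c n n - c n 1) * U 0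
      + (\<Sum>k=1..<n. \<Sum>j=1..k. ?d k * (tau \<alpha> t k * ?\<theta> k j) * F j)"
    unfolding sum_increments[OF n, of "c n", symmetric]
    by (simp add: distrib_left sum.distrib sum_distrib_right sum_distrib_left mult.assoc)
  also have "(\<Sum>k=1..<n. \<Sum>j=1..k. ?d k * (tau \<alpha> t k * ?\<theta> k j) * F j)
      = (\<Sum>k=1..<n. \<Sum>j\<in>{j\<in>{1..<n}. j \<le> k}. ?d k * (tau \<alpha> t k * ?\<theta> k j) * F j)"
    by (intro sum.cong) auto
  also have "\<dots> = (\<Sum>j=1..<n. \<Sum>k\<in>{k\<in>{1..<n}. j \<le> k}. ?d k * (tau \<alpha> t k * ?\<theta> k j) * F j)"
    by (rule sum.swap_restrict) auto
  also have "\<dots> = (\<Sum>j=1..<n. ?\<theta> n j * F j)"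
  proof (rule sum.cong)
    fix j assume j: "j \<in> {1..<n}"
    then have "{k\<in>{1..<n}. j \<le> k} = {j..<n}" by auto
    then show "(\<Sum>k\<in>{k\<in>{1..<n}. j \<le> k}. ?d k * (tau \<alpha> t k * ?\<theta> k j) * F j) = ?\<theta> n j * F j"
      using j by (simp add: theta_recursion sum_distrib_right)
  qed simp
  finally have "c n n * U n \<le> c n n * U 0 + ((\<Sum>j=1..<n. ?\<theta> n j * F j) + F n)"
    using step[OF less.prems] by (simp add: algebra_simps)
  also have "(\<Sum>j=1..<n. ?\<theta> n j * F j) + F n = (\<Sum>j=1..n. ?\<theta> n j * F j)"
    using n by (simp add: sum.last_plus theta.simps[of \<alpha> t c n n])
  finally show ?case using pos[OF less.prems] by (simp add: field_simps)
qed

theorem theorem3p2: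
  fixes \<alpha> s \<gamma> \<kappa> T \<omega> \<epsilon> C ymin ymax :: real
    and a b :: "real^'d" and m :: "'d \<Rightarrow> nat" and r n_dof N Q :: nat
    and \<phi> :: "nat \<Rightarrow> real^'d \<Rightarrow> real"
    and t w \<xi> :: "nat \<Rightarrow> real" and \<beta> c \<theta> :: "nat \<Rightarrow> nat \<Rightarrow> real"
    and f :: "real^'d \<Rightarrow> real \<Rightarrow> real" and u :: "nat \<Rightarrow> real^'d \<Rightarrow> real"
    and \<Omega> :: "(real^'d) set" and V :: "(real^'d \<Rightarrow> real) set"
  defines "\<Omega> \<equiv> box a b"
    and "V \<equiv> fe_space a b m r"
    and "t \<equiv> graded_mesh T N \<omega>"
    and "w \<equiv> soe_weight \<alpha> Q ymin ymax"
    and "\<xi> \<equiv> soe_exponent Q ymin ymax"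
    and "c \<equiv> cbar \<beta>"
    and "\<theta> \<equiv> theta \<alpha> t c"
  assumes "0 < \<alpha>" "\<alpha> < 1" "0 < s" "s < 1" "0 \<le> \<gamma>" "0 < \<kappa>" "0 < T"
    and "CARD('d) \<in> {1, 2, 3}" and "\<And>k. vec_nth a k < vec_nth b k"
    and "\<And>k. 1 \<le> m k" and "1 \<le> r" and "fe_basis V n_dof \<phi>"
    and "1 \<le> N" and "1 \<le> \<omega>"
    and "1 < Q" and "ymin < ymax" and "0 < \<epsilon>"
    and soe: "\<And>y. y \<in> {t 1..T} \<Longrightarrow>
          \<bar>(\<Sum>j=1..Q. w j * exp (\<xi> j * y)) - y powr (-1 - \<alpha>) / Gamma (-\<alpha>)\<bar>
            \<le> C * \<epsilon> * y powr (-1 - \<alpha>)"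
    and coeffs: "\<And>n \<rho>. n \<in> {1..N} \<Longrightarrow> (\<Sum>k=0..n. \<beta> n k * \<rho> k) = fast_caputo \<alpha> t Q w \<xi> \<rho> n"
    and monotone: "\<And>n k. n \<in> {1..N} \<Longrightarrow> k \<in> {1..<n} \<Longrightarrow> c n k \<le> c n (k + 1)"
    and lower: "\<And>n. n \<in> {1..N} \<Longrightarrow>
          c n 1 \<ge> t n powr (-\<alpha>) / Gamma (1 - \<alpha>) \<and> t n powr (-\<alpha>) / Gamma (1 - \<alpha>) > 0"
    and "\<And>n. n \<in> {1..N} \<Longrightarrow> (\<lambda>x. f x (t n)) \<in> L2_set_on \<Omega>"
    and "\<And>n. n \<in> {0..N} \<Longrightarrow> u n \<in> V"
    and scheme: "\<And>n v. n \<in> {1..N} \<Longrightarrow> v \<in> V \<Longrightarrow>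
          L2_inner \<Omega> (\<lambda>x. \<Sum>k=1..n. c n k * (u k x - u (k - 1) x)) v
            + \<kappa> * frac_form \<Omega> n_dof \<phi> \<gamma> s (u n) v
          = L2_inner \<Omega> (\<lambda>x. f x (t n)) v"
  shows "\<forall>n\<in>{1..N}.
           L2_norm \<Omega> (u n) \<le> L2_norm \<Omega> (u 0)
             + 1 / c n n * (\<Sum>j=1..n. \<theta> n j * L2_norm \<Omega> (\<lambda>x. f x (t j)))
           \<and> 1 / c n n = tau \<alpha> t n"
proof
  fix n assume nN: "n \<in> {1..N}"
  have continuous: "continuous_on UNIV (u k)" if "k \<in> {0..N}" for k
    using \<open>\<And>n. n \<in> {0..N} \<Longrightarrow> u n \<in> V\<close>[OF that] unfolding V_def by (rule fe_space_continuous)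
  have u_L2: "u k \<in> L2_set_on \<Omega>" if "k \<in> {0..N}" for k
    unfolding \<Omega>_def using continuous[OF that] by (rule continuous_in_L2_set_on_box)
  have c_diag: "c k k = 1 / tau \<alpha> t k" if "k \<in> {1..N}" for k
    unfolding c_def using that coeffs[OF that] by (intro cbar_leading_coefficient) auto
  have c_first: "0 < c k 1" if "k \<in> {1..N}" for k
    using lower[OF that] by linarith
  have c_pos: "0 < c k k" if k: "k \<in> {1..N}" for k
  proof -
    have "0 \<le> (\<Sum>i=1..<k. c k (i + 1) - c k i)"
      using monotone[OF k] by (intro sum_nonneg) simp
    then show ?thesis using sum_increments[of k "c k"] c_first[OF k] k by simp
  qed
  have step: "c k k * L2_norm \<Omega> (u k) \<le> c k 1 * L2_norm \<Omega> (u 0)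
      + (\<Sum>i=1..<k. (c k (i + 1) - c k i) * L2_norm \<Omega> (u i)) + L2_norm \<Omega> (\<lambda>x. f x (t k))"
    if k: "k \<in> {1..N}" for k
  proof (rule energy_step[where g = "\<lambda>i. L2_inner \<Omega> (u i) (u k)"])
    show "\<bar>L2_inner \<Omega> (u i) (u k)\<bar> \<le> L2_norm \<Omega> (u i) * L2_norm \<Omega> (u k)" if "i < k" for i
      using k that by (intro L2_Cauchy_Schwarz u_L2) auto
    have uk: "u k \<in> V" using \<open>\<And>n. n \<in> {0..N} \<Longrightarrow> u n \<in> V\<close> k by simp
    have "(\<Sum>i=1..k. c k i * (L2_inner \<Omega> (u i) (u k) - L2_inner \<Omega> (u (i - 1)) (u k)))
        = (\<Sum>i=1..k. c k i * L2_inner \<Omega> (\<lambda>x. u i x - u (i - 1) x) (u k))"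
      using k by (intro sum.cong refl arg_cong[of _ _ "\<lambda>y. c k _ * y"] L2_inner_diff_left[symmetric] u_L2) auto
    also have "\<dots> = L2_inner \<Omega> (\<lambda>x. \<Sum>i=1..k. c k i * (u i x - u (i - 1) x)) (u k)"
      using k unfolding \<Omega>_def
      by (intro L2_inner_sum_left[symmetric] continuous_in_L2_set_on_box continuous_intros continuous) auto
    also have "\<dots> \<le> L2_inner \<Omega> (\<lambda>x. f x (t k)) (u k)"
    proof -
      have "0 \<le> frac_form \<Omega> n_dof \<phi> \<gamma> s (u k) (u k)"
        unfolding \<Omega>_def using \<open>fe_basis V n_dof \<phi>\<close> uk unfolding V_def by (rule frac_form_nonneg)
      then have "0 \<le> \<kappa> * frac_form \<Omega> n_dof \<phi> \<gamma> s (u k) (u k)" using \<open>0 < \<kappa>\<close> by simp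
      with scheme[OF k uk] show ?thesis by linarith
    qed
    also have "\<dots> \<le> L2_norm \<Omega> (\<lambda>x. f x (t k)) * L2_norm \<Omega> (u k)"
      using L2_Cauchy_Schwarz[OF \<open>\<And>n. n \<in> {1..N} \<Longrightarrow> (\<lambda>x. f x (t n)) \<in> L2_set_on \<Omega>\<close>[OF k], of "u k"]
        u_L2[of k] k by simp
    finally show "(\<Sum>i=1..k. c k i * (L2_inner \<Omega> (u i) (u k) - L2_inner \<Omega> (u (i - 1)) (u k)))
        \<le> L2_norm \<Omega> (\<lambda>x. f x (t k)) * L2_norm \<Omega> (u k)" .
  qed (use k c_first[OF k] monotone[OF k] in \<open>auto simp: L2_norm_nonneg L2_norm_power2\<close>)
  have "L2_norm \<Omega> (u n) \<le> L2_norm \<Omega> (u 0)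
      + 1 / c n n * (\<Sum>j=1..n. \<theta> n j * L2_norm \<Omega> (\<lambda>x. f x (t j)))"
    unfolding \<theta>_def
    by (rule discrete_fractional_Gronwall[where U = "\<lambda>k. L2_norm \<Omega> (u k)" and F = "\<lambda>j. L2_norm \<Omega> (\<lambda>x. f x (t j))",
          OF monotone c_pos c_diag step nN])
  moreover have "1 / c n n = tau \<alpha> t n" by (simp add: c_diag[OF nN])
  ultimately show "L2_norm \<Omega> (u n) \<le> L2_norm \<Omega> (u 0)
      + 1 / c n n * (\<Sum>j=1..n. \<theta> n j * L2_norm \<Omega> (\<lambda>x. f x (t j))) \<and> 1 / c n n = tau \<alpha> t n"
    by blast
qed

end
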